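(* Let $m_1,m_2,m_3>0$, $\alpha\ge1$, and let $a$ be the Lagrange equilateral-triangle central configuration of the $3$-body problem with masses $m_1,m_2,m_3$ and exponent $\alpha$. Put $$\beta=27\,\frac{m_1m_2+m_1m_3+m_2m_3}{(m_1+m_2+m_3)^2}.$$ (1) If $\alpha=2$ and $\beta>1$, then $a$ is $2\pi/m$-nondegenerate for every integer $m>1$. (2) If $\alpha\ne2$, $p$ is a positive integer with $p\,(3-\alpha)^{1/2}\notin\mathbb{N}$, and $$\beta>9\left(\frac{3-\alpha}{1+\alpha}\right)^2,$$ then $a$ is $2\pi p$-nondegenerate.
   Context: $\mathbb{N}=\{1,2,\dots\}$. $E=\mathbb{R}^2$, $J=\begin{pmatrix}0&-1\\1&0\end{pmatrix}$, $\mathcal J_3=J\oplus J\oplus J$ on $E^3$, $\mathcal M=m_1I\oplus m_2I\oplus m_3I$. $\phi_\alpha$ satisfies $\phi_\alpha'(r)=-r^{-\alpha}$. $V(u)=\frac12\|\mathcal M^{1/2}u\|^2+\sum_{1\le i<j\le3}m_im_j\phi_\alpha(\|u_i-u_j\|)$ is the amended potential. $E_{red}=\{u\in E^3:\sum_im_iu_i=0\}$. The Lagrange triangular configuration $a=(a_1,a_2,a_3)\in E_{red}$ is the critical point of $V$ whose three points are the vertices of an equilateral triangle (with side $d$, $d^{\alpha+1}=m_1+m_2+m_3$). Let $M_a(\lambda)=\lambda^2\mathcal M-2i\lambda\mathcal M\mathcal J_3+\nabla^2V[a]$ and let $P$ be the orthogonal projection of $(E^3)^{\mathbb{C}}$ onto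 $(E_{red})^{\mathbb{C}}$. For a nonzero integer $p$, $a$ is $2\pi p$-nondegenerate if $P M_a(\ell/p)|_{(E_{red})^{\mathbb{C}}}$ is invertible for all $\ell\in\mathbb{Z}\setminus\{0\}$ and $PM_a(0)|_{(E_{red})^{\mathbb{C}}}$ has kernel spanned by $\mathcal J_3a$. For an integer $m>1$, $a$ is $2\pi/m$-nondegenerate if $PM_a(\ell)|_{(E_{red})^{\mathbb{C}}}$ is invertible for all $\ell\in m\mathbb{Z}\setminus\{0\}$ and $PM_a(0)|_{(E_{red})^{\mathbb{C}}}$ has kernel spanned by $\mathcal J_3a$. *)

theory Defs
  imports "HOL-Analysis.Analysis"
begin

type_synonym E = "real ^ 2"
type_synonym E3 = "E ^ 3"
type_synonym E3C = "complex ^ 2 ^ 3"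

definition J :: "real ^ 2 ^ 2"
  where "J = vector [vector [0, -1], vector [1, 0]]"

definition J3 :: "E3 \<Rightarrow> E3"
  where "J3 u = (\<chi> i. J *v (u $ i))"

definition diag_op :: "real ^ 3 \<Rightarrow> E3 \<Rightarrow> E3"
  where "diag_op c u = (\<chi> i. (c $ i) *\<^sub>R (u $ i))"

abbreviation mass_op :: "real ^ 3 \<Rightarrow> E3 \<Rightarrow> E3"
  where "mass_op m \<equiv> diag_op m"

abbreviation sqrt_mass_op :: "real ^ 3 \<Rightarrow> E3 \<Rightarrow> E3"
  where "sqrt_mass_op m \<equiv> diag_op (\<chi> i. sqrt (m $ i))"

text \<open>The pair potential is only determined by its derivative, hence up to an additive constant
  on the positive half line; its values elsewhere are irrelevant.\<close>

definition is_pair_potential :: "real \<Rightarrow> (real \<Rightarrow> real) \<Rightarrow> bool"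
  where "is_pair_potential \<alpha> \<phi> \<longleftrightarrow>
    (\<forall>r>0. (\<phi> has_real_derivative - (r powr (- \<alpha>))) (at r))"

text \<open>The index pairs are listed explicitly: in the numeral type 3 the index 3 coincides with 0,
  so the order of that type is not the usual one on 1, 2, 3.\<close>

definition amended_potential :: "real ^ 3 \<Rightarrow> (real \<Rightarrow> real) \<Rightarrow> E3 \<Rightarrow> real"
  where "amended_potential m \<phi> u =
    (norm (sqrt_mass_op m u))\<^sup>2 / 2
    + (\<Sum>(i, j) \<in> {(1, 2), (1, 3), (2, 3)}. m $ i * m $ j * \<phi> (norm (u $ i - u $ j)))"

definition gradient :: "('a::real_inner \<Rightarrow> real) \<Rightarrow> 'a \<Rightarrow> 'a"
  where "gradient f x = (THE D. GDERIV f x :> D)"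

definition hessian :: "('a::real_inner \<Rightarrow> real) \<Rightarrow> 'a \<Rightarrow> 'a \<Rightarrow> 'a"
  where "hessian f x = frechet_derivative (gradient f) (at x)"

definition E_red :: "real ^ 3 \<Rightarrow> E3 set"
  where "E_red m = {u. (\<Sum>i\<in>UNIV. (m $ i) *\<^sub>R (u $ i)) = 0}"

definition lagrange_configuration ::
    "real ^ 3 \<Rightarrow> real \<Rightarrow> (real \<Rightarrow> real) \<Rightarrow> E3 \<Rightarrow> bool"
  where "lagrange_configuration m \<alpha> \<phi> a \<longleftrightarrow>
    a \<in> E_red m \<and>
    GDERIV (amended_potential m \<phi>) a :> 0 \<and>
    (\<exists>d>0. d powr (\<alpha> + 1) = m $ 1 + m $ 2 + m $ 3 \<and>
      norm (a $ 1 - a $ 2) = d \<and> norm (a $ 1 - a $ 3) = d \<and> norm (a $ 2 - a $ 3) = d)"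

definition of_E3 :: "E3 \<Rightarrow> E3C"
  where "of_E3 u = (\<chi> i j. of_real (u $ i $ j))"

definition Re3 :: "E3C \<Rightarrow> E3"
  where "Re3 z = (\<chi> i j. Re (z $ i $ j))"

definition Im3 :: "E3C \<Rightarrow> E3"
  where "Im3 z = (\<chi> i j. Im (z $ i $ j))"

definition cscale :: "complex \<Rightarrow> E3C \<Rightarrow> E3C"
  where "cscale c z = (\<chi> i j. c * z $ i $ j)"

definition complexify_set :: "E3 set \<Rightarrow> E3C set"
  where "complexify_set S = {z. Re3 z \<in> S \<and> Im3 z \<in> S}"

definition complexify_op :: "(E3 \<Rightarrow> E3) \<Rightarrow> E3C \<Rightarrow> E3C"
  where "complexify_op T z = of_E3 (T (Re3 z)) + cscale \<i> (of_E3 (T (Im3 z)))"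

definition hermitian :: "E3C \<Rightarrow> E3C \<Rightarrow> complex"
  where "hermitian z w = (\<Sum>i\<in>UNIV. \<Sum>j\<in>UNIV. z $ i $ j * cnj (w $ i $ j))"

definition orthogonal_projection :: "E3C set \<Rightarrow> E3C \<Rightarrow> E3C"
  where "orthogonal_projection S z = (THE w. w \<in> S \<and> (\<forall>v\<in>S. hermitian (z - w) v = 0))"

definition M_op :: "real ^ 3 \<Rightarrow> (real \<Rightarrow> real) \<Rightarrow> E3 \<Rightarrow> complex \<Rightarrow> E3C \<Rightarrow> E3C"
  where "M_op m \<phi> a \<mu> z =
    cscale (\<mu>\<^sup>2) (complexify_op (mass_op m) z)
    - cscale (2 * \<i> * \<mu>) (complexify_op (mass_op m \<circ> J3) z)
    + complexify_op (hessian (amended_potential m \<phi>) a) z"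

definition PM_op :: "real ^ 3 \<Rightarrow> (real \<Rightarrow> real) \<Rightarrow> E3 \<Rightarrow> complex \<Rightarrow> E3C \<Rightarrow> E3C"
  where "PM_op m \<phi> a \<mu> z = orthogonal_projection (complexify_set (E_red m)) (M_op m \<phi> a \<mu> z)"

definition PM_invertible :: "real ^ 3 \<Rightarrow> (real \<Rightarrow> real) \<Rightarrow> E3 \<Rightarrow> complex \<Rightarrow> bool"
  where "PM_invertible m \<phi> a \<mu> \<longleftrightarrow>
    bij_betw (PM_op m \<phi> a \<mu>) (complexify_set (E_red m)) (complexify_set (E_red m))"

definition PM_zero_kernel_spanned :: "real ^ 3 \<Rightarrow> (real \<Rightarrow> real) \<Rightarrow> E3 \<Rightarrow> bool"
  where "PM_zero_kernel_spanned m \<phi> a \<longleftrightarrow>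
    {z \<in> complexify_set (E_red m). PM_op m \<phi> a 0 z = 0} = range (\<lambda>c. cscale c (of_E3 (J3 a)))"

text \<open>Nondegeneracy with respect to the periods \<open>2\<pi>p\<close> (\<open>p \<noteq> 0\<close>) and \<open>2\<pi>/k\<close> (\<open>k > 1\<close>).\<close>

definition nondegenerate_mult ::
    "real ^ 3 \<Rightarrow> (real \<Rightarrow> real) \<Rightarrow> E3 \<Rightarrow> int \<Rightarrow> bool"
  where "nondegenerate_mult m \<phi> a p \<longleftrightarrow>
    (\<forall>l::int. l \<noteq> 0 \<longrightarrow> PM_invertible m \<phi> a (of_int l / of_int p)) \<and>
    PM_zero_kernel_spanned m \<phi> a"

definition nondegenerate_frac ::
    "real ^ 3 \<Rightarrow> (real \<Rightarrow> real) \<Rightarrow> E3 \<Rightarrow> int \<Rightarrow> bool"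
  where "nondegenerate_frac m \<phi> a k \<longleftrightarrow>
    (\<forall>l::int. l \<noteq> 0 \<and> k dvd l \<longrightarrow> PM_invertible m \<phi> a (of_int l)) \<and>
    PM_zero_kernel_spanned m \<phi> a"

definition beta :: "real ^ 3 \<Rightarrow> real"
  where "beta m = 27 * (m $ 1 * m $ 2 + m $ 1 * m $ 3 + m $ 2 * m $ 3) / (m $ 1 + m $ 2 + m $ 3)\<^sup>2"

end

theory Submission imports Defs begin

text \<open>
  Write \<open>M\<close> for the total mass, \<open>e\<^sub>i\<^sub>j = (a\<^sub>i - a\<^sub>j) / d\<close> for the unit edge vectors and
  \<open>\<gamma> = \<alpha> + 1\<close>. On centred vectors the relation \<open>d\<^bsup>\<gamma>\<^esup> = M\<close> makes the mass term of the Hessian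
  cancel against the isotropic part of the pair interactions, and what remains is
  \<open>(H w)\<^sub>i = (\<gamma> m\<^sub>i / M) \<Sum>\<^sub>j m\<^sub>j \<langle>e\<^sub>i\<^sub>j, w\<^sub>i - w\<^sub>j\<rangle> e\<^sub>i\<^sub>j\<close> (\<open>hess_reduced\<close>). Consequently the components of
  \<open>M\<^sub>a(\<lambda>) w\<close> sum to zero, whereas the orthogonal complement of the reduced space consists of the
  vectors \<open>(m\<^sub>i v)\<^sub>i\<close>. So the projection destroys no information, \<open>P M\<^sub>a(\<lambda>) w = 0\<close> iff
  \<open>M\<^sub>a(\<lambda>) w = 0\<close> (\<open>PM_op_eq_0_iff\<close>), and invertibility is triviality of this kernel by a dimension
  count.

  To find the kernel, subtract the equations of two bodies. With \<open>W\<^sub>k\<close> the difference of \<open>w\<close> along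
  the side opposite to vertex \<open>k\<close>, \<open>e\<^sub>k\<close> the matching unit vector, \<open>s\<^sub>k = \<langle>e\<^sub>k, W\<^sub>k\<rangle>\<close>,
  \<open>S = \<Sum>\<^sub>k s\<^sub>k e\<^sub>k\<close> and \<open>\<mu>\<^sub>k = m\<^sub>k / M\<close>, they read
  \<open>\<lambda>\<^sup>2 W\<^sub>k - 2 i \<lambda> J W\<^sub>k + \<gamma> (s\<^sub>k e\<^sub>k - \<mu>\<^sub>k S) = 0\<close>. The components along \<open>J e\<^sub>k\<close>, weighted by \<open>e\<^sub>k\<close>
  and summed under the constraint \<open>\<Sum>\<^sub>k W\<^sub>k = 0\<close>, give
  \<open>(\<lambda>\<^sup>2 + 2 i \<lambda> J + \<gamma> A) J S = 0\<close> with \<open>A = \<Sum>\<^sub>k \<mu>\<^sub>k e\<^sub>k e\<^sub>k\<^sup>T\<close>. Here \<open>A\<close> has trace \<open>1\<close> and, because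
  the triangle is equilateral, determinant \<open>\<beta> / 36\<close>, so the determinant of the system is
  \<open>\<lambda>\<^sup>4 - (3 - \<alpha>) \<lambda>\<^sup>2 + \<gamma>\<^sup>2 \<beta> / 36\<close>. The lower bound on \<open>\<beta>\<close> says exactly that this quadratic in
  \<open>\<lambda>\<^sup>2\<close> has negative discriminant; hence \<open>S = 0\<close> for every real \<open>\<lambda>\<close>. The remaining equations then
  give \<open>(\<lambda>\<^sup>2 - (3 - \<alpha>)) s\<^sub>k = 0\<close> if \<open>\<lambda> \<noteq> 0\<close>, so that the kernel is trivial unless
  \<open>\<lambda>\<^sup>2 = 3 - \<alpha>\<close>, the frequency of the homographic motions; at \<open>\<lambda> = 0\<close> they leave only the common
  rotation \<open>J\<^sub>3 a\<close> (\<open>triangle_equations_solution\<close>, \<open>M_op_kernel\<close>). The excluded frequency is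
  \<open>\<plusminus>1\<close> for \<open>\<alpha> = 2\<close>, and for the periods \<open>2\<pi>p\<close> it is ruled out by the hypothesis on \<open>p\<close>.
\<close>

section \<open>Gradient and Hessian of the amended potential\<close>

definition pair_force :: "real \<Rightarrow> E \<Rightarrow> E"
  where "pair_force \<alpha> x = (norm x powr (- (\<alpha> + 1))) *\<^sub>R x"

definition pair_force_deriv :: "real \<Rightarrow> E \<Rightarrow> E \<Rightarrow> E"
  where "pair_force_deriv \<alpha> x h =
    (norm x powr (- (\<alpha> + 1))) *\<^sub>R (h - ((\<alpha> + 1) * (x \<bullet> h) / (norm x)\<^sup>2) *\<^sub>R x)"

text \<open>The adjoint of the difference map \<open>u \<mapsto> u\<^sub>i - u\<^sub>j\<close>; through it the gradient of a pair term is
  the pair of opposite forces on the two bodies.\<close>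

definition opposite :: "3 \<Rightarrow> 3 \<Rightarrow> E \<Rightarrow> E3"
  where "opposite i j v = axis i v - axis j v"

lemma inner_opposite: "opposite i j v \<bullet> u = v \<bullet> (u $ i - u $ j)"
  by (simp add: opposite_def inner_diff_left inner_diff_right inner_axis')

lemma bounded_linear_opposite: "bounded_linear (opposite i j)"
proof -
  have "linear (opposite i j)"
    by (rule linearI) (simp_all add: opposite_def axis_def vec_eq_iff)
  then show ?thesis by (rule linear_conv_bounded_linear[THEN iffD1])
qed

lemma bounded_linear_diag_op: "bounded_linear (diag_op c)"
proof -
  have "linear (diag_op c)"
    by (rule linearI) (simp_all add: diag_op_def vec_eq_iff algebra_simps)
  then show ?thesis by (rule linear_conv_bounded_linear[THEN iffD1])
qed

lemma bounded_linear_diff_nth: "bounded_linear (\<lambda>u :: E3. u $ i - u $ j)"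
  by (intro bounded_linear_sub bounded_linear_vec_nth)

lemma has_derivative_pair_force:
  assumes "x \<noteq> 0"
  shows "(pair_force \<alpha> has_derivative pair_force_deriv \<alpha> x) (at x)"
proof -
  have n: "norm x > 0" using assms by simp
  have "((\<lambda>x. (norm x powr (- (\<alpha> + 1))) *\<^sub>R x) has_derivative 
     (\<lambda>h. norm x powr (- (\<alpha> + 1)) *\<^sub>R h + 
       (norm x powr (- (\<alpha> + 1)) * (0 * ln (norm x) + (h \<bullet> sgn x) * (- (\<alpha> + 1)) / norm x)) *\<^sub>R x)) (at x)"
    using has_derivative_scaleR[OF has_derivative_powr[OF has_derivative_norm[OF assms] has_derivative_const n UNIV_I, of "-(\<alpha>+1)"] has_derivative_ident]
    by (simp add: inner_commute)
  moreover have "norm x powr (- (\<alpha> + 1)) *\<^sub>R h + 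
       (norm x powr (- (\<alpha> + 1)) * (0 * ln (norm x) + (h \<bullet> sgn x) * (- (\<alpha> + 1)) / norm x)) *\<^sub>R x
     = pair_force_deriv \<alpha> x h" for h
  proof -
    have "h \<bullet> sgn x = (x \<bullet> h) / norm x"
      by (simp add: sgn_div_norm inner_commute divide_inverse)
    then show ?thesis
      using n by (simp add: pair_force_deriv_def scaleR_diff_right power2_eq_square divide_inverse algebra_simps)
  qed
  ultimately show ?thesis by (simp add: pair_force_def[abs_def])
qed

lemma has_derivative_pair_term:
  assumes pot: "is_pair_potential \<alpha> \<phi>" and ne: "u $ i \<noteq> u $ j"
  shows "((\<lambda>u :: E3. \<phi> (norm (u $ i - u $ j))) has_derivative
    (\<lambda>h. - (opposite i j (pair_force \<alpha> (u $ i - u $ j)) \<bullet> h))) (at u)"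
proof -
  let ?x = "u $ i - u $ j"
  have ne': "?x \<noteq> 0" using ne by simp
  have d1: "((\<lambda>u :: E3. u $ i - u $ j) has_derivative (\<lambda>h. h $ i - h $ j)) (at u)"
    by (rule bounded_linear_imp_has_derivative[OF bounded_linear_diff_nth])
  have d2: "((\<lambda>u :: E3. norm (u $ i - u $ j)) has_derivative (\<lambda>h. (h $ i - h $ j) \<bullet> sgn ?x)) (at u)"
    using has_derivative_compose[OF d1 has_derivative_norm[OF ne']] by (simp add: inner_commute)
  have d3: "(\<phi> has_real_derivative - (norm ?x powr (- \<alpha>))) (at (norm ?x))"
    using pot ne' by (simp add: is_pair_potential_def)
  have "- (norm ?x powr (- \<alpha>)) * ((h $ i - h $ j) \<bullet> sgn ?x)
      = - (opposite i j (pair_force \<alpha> ?x) \<bullet> h)" for h :: E3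
  proof -
    have "norm ?x powr (- \<alpha>) = norm ?x powr (- (\<alpha> + 1)) * norm ?x"
      using ne' powr_add[of "norm ?x" "- (\<alpha> + 1)" 1] by simp
    then show ?thesis
      using ne' by (simp add: inner_opposite pair_force_def sgn_div_norm inner_commute[of "h $ i - h $ j"])
  qed
  then show ?thesis
    using has_derivative_compose[OF d2 d3[unfolded has_field_derivative_def]] by simp
qed

definition potential_gradient :: "real ^ 3 \<Rightarrow> real \<Rightarrow> E3 \<Rightarrow> E3"
  where "potential_gradient m \<alpha> u = mass_op m u
    - (\<Sum>(i, j) \<in> {(1, 2), (1, 3), (2, 3)}.
        (m $ i * m $ j) *\<^sub>R opposite i j (pair_force \<alpha> (u $ i - u $ j)))"

definition potential_hessian :: "real ^ 3 \<Rightarrow> real \<Rightarrow> E3 \<Rightarrow> E3 \<Rightarrow> E3"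
  where "potential_hessian m \<alpha> u h = mass_op m h
    - (\<Sum>(i, j) \<in> {(1, 2), (1, 3), (2, 3)}.
        (m $ i * m $ j) *\<^sub>R opposite i j (pair_force_deriv \<alpha> (u $ i - u $ j) (h $ i - h $ j)))"

definition noncollision :: "E3 set"
  where "noncollision = {u. u $ 1 \<noteq> u $ 2 \<and> u $ 1 \<noteq> u $ 3 \<and> u $ 2 \<noteq> u $ 3}"

lemma open_noncollision: "open noncollision"
proof -
  have *: "open {u :: E3. u $ i \<noteq> u $ j}" for i j
    by (intro open_Collect_neq continuous_intros)
  show ?thesis unfolding noncollision_def by (intro open_Collect_conj *)
qed

lemma GDERIV_amended_potential:
  assumes m: "\<And>i. m $ i > 0" and pot: "is_pair_potential \<alpha> \<phi>" and u: "u \<in> noncollision"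
  shows "GDERIV (amended_potential m \<phi>) u :> potential_gradient m \<alpha> u"
proof -
  have sq: "(norm (sqrt_mass_op m u))\<^sup>2 / 2 = (mass_op m u \<bullet> u) / 2" for u
  proof -
    have "sqrt (m $ i) * x * (sqrt (m $ i) * x) = m $ i * x * x" for i x
    proof -
      have "sqrt (m $ i) * x * (sqrt (m $ i) * x) = sqrt (m $ i) * sqrt (m $ i) * (x * x)"
        by (simp only: mult_ac)
      then show ?thesis using m[of i] by (simp add: mult.assoc)
    qed
    then show ?thesis
      by (simp only: power2_norm_eq_inner inner_vec_def diag_op_def vec_lambda_beta
          vector_scaleR_component real_scaleR_def inner_real_def)
  qed
  have d0: "((\<lambda>u. (mass_op m u \<bullet> u) / 2) has_derivative (\<lambda>h. mass_op m u \<bullet> h)) (at u)"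
  proof -
    have "((\<lambda>u. (mass_op m u \<bullet> u) / 2) has_derivative (\<lambda>h. (mass_op m u \<bullet> h + mass_op m h \<bullet> u) / 2)) (at u)"
      by (auto intro!: derivative_eq_intros bounded_linear_imp_has_derivative[OF bounded_linear_diag_op])
    moreover have "mass_op m h \<bullet> u = mass_op m u \<bullet> h" for h
      by (simp add: diag_op_def inner_vec_def inner_commute mult_ac)
    ultimately show ?thesis by simp
  qed
  have ne: "u $ 1 \<noteq> u $ 2" "u $ 1 \<noteq> u $ 3" "u $ 2 \<noteq> u $ 3"
    using u by (auto simp: noncollision_def)
  note p = has_derivative_pair_term[OF pot]
  have "((\<lambda>u. (mass_op m u \<bullet> u) / 2 + (m $ 1 * m $ 2 * \<phi> (norm (u $ 1 - u $ 2)) +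
      (m $ 1 * m $ 3 * \<phi> (norm (u $ 1 - u $ 3)) + m $ 2 * m $ 3 * \<phi> (norm (u $ 2 - u $ 3)))))
    has_derivative (\<lambda>h. mass_op m u \<bullet> h +
      (m $ 1 * m $ 2 * (- (opposite 1 2 (pair_force \<alpha> (u $ 1 - u $ 2)) \<bullet> h)) +
      (m $ 1 * m $ 3 * (- (opposite 1 3 (pair_force \<alpha> (u $ 1 - u $ 3)) \<bullet> h)) +
       m $ 2 * m $ 3 * (- (opposite 2 3 (pair_force \<alpha> (u $ 2 - u $ 3)) \<bullet> h)))))) (at u)"
    by (intro has_derivative_add has_derivative_mult_right d0 p ne)
  then show ?thesis
    by (simp add: gderiv_def amended_potential_def[abs_def] potential_gradient_def sq
        inner_diff_left inner_add_left inner_commute algebra_simps)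
qed

lemma gradient_eqI:
  assumes "GDERIV f x :> D"
  shows "gradient f x = D"
  unfolding gradient_def
proof (rule the_equality, rule assms)
  fix D' assume "GDERIV f x :> D'"
  then have "(\<lambda>h. h \<bullet> D') = (\<lambda>h. h \<bullet> D)"
    using assms has_derivative_unique unfolding gderiv_def by blast
  then show "D' = D" by (metis vector_eq_rdot inner_commute)
qed

lemma has_derivative_potential_gradient:
  assumes u: "u \<in> noncollision"
  shows "(potential_gradient m \<alpha> has_derivative potential_hessian m \<alpha> u) (at u)"
proof -
  have p: "((\<lambda>u :: E3. (m $ i * m $ j) *\<^sub>R opposite i j (pair_force \<alpha> (u $ i - u $ j))) has_derivative
     (\<lambda>h. (m $ i * m $ j) *\<^sub>R opposite i j (pair_force_deriv \<alpha> (u $ i - u $ j) (h $ i - h $ j)))) (at u)"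
    if "u $ i \<noteq> u $ j" for i j
  proof -
    have "((\<lambda>u :: E3. u $ i - u $ j) has_derivative (\<lambda>h. h $ i - h $ j)) (at u)"
      by (rule bounded_linear_imp_has_derivative[OF bounded_linear_diff_nth])
    from has_derivative_compose[OF this has_derivative_pair_force]
    have "((\<lambda>u :: E3. pair_force \<alpha> (u $ i - u $ j)) has_derivative
       (\<lambda>h. pair_force_deriv \<alpha> (u $ i - u $ j) (h $ i - h $ j))) (at u)" using that by simp
    then show ?thesis
      by (intro has_derivative_scaleR_right bounded_linear.has_derivative[OF bounded_linear_opposite])
  qed
  have ne: "u $ 1 \<noteq> u $ 2" "u $ 1 \<noteq> u $ 3" "u $ 2 \<noteq> u $ 3"
    using u by (auto simp: noncollision_def)
  note d0 = bounded_linear_imp_has_derivative[OF bounded_linear_diag_op]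
  from has_derivative_diff[OF d0
      has_derivative_add[OF p[OF ne(1)] has_derivative_add[OF p[OF ne(2)] p[OF ne(3)]]]]
  show ?thesis
    by (simp add: potential_gradient_def[abs_def] potential_hessian_def[abs_def])
qed

text \<open>Collisions form a closed set, so the gradient is given by one formula on a whole neighbourhood of
  a collision-free configuration; this is what allows it to be differentiated once more.\<close>

lemma
  assumes m: "\<And>i. m $ i > 0" and pot: "is_pair_potential \<alpha> \<phi>" and u: "u \<in> noncollision"
  shows hessian_amended_potential: "hessian (amended_potential m \<phi>) u = potential_hessian m \<alpha> u"
    and linear_hessian: "linear (hessian (amended_potential m \<phi>) u)"
proof -
  have "(gradient (amended_potential m \<phi>) has_derivative potential_hessian m \<alpha> u) (at u)"
    by (rule has_derivative_transform_within_open[OF has_derivative_potential_gradient[OF u] open_noncollision u])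
      (simp add: gradient_eqI[OF GDERIV_amended_potential[OF m pot]])
  then show "hessian (amended_potential m \<phi>) u = potential_hessian m \<alpha> u"
    unfolding hessian_def by (metis frechet_derivative_at)
  with \<open>(gradient _ has_derivative _) _\<close> show "linear (hessian (amended_potential m \<phi>) u)"
    by (simp add: has_derivative_linear)
qed

section \<open>The projection onto the reduced space\<close>

lemma mem_reduced_space:
  "z \<in> complexify_set (E_red m) \<longleftrightarrow>
    (\<forall>j. (\<Sum>i\<in>UNIV. complex_of_real (m $ i) * z $ i $ j) = 0)"
  by (auto simp: complexify_set_def E_red_def Re3_def Im3_def vec_eq_iff complex_eq_iff sum_3 forall_2)

lemma subspace_reduced: "subspace (complexify_set (E_red m))"
proof -
  have "(\<Sum>i\<in>UNIV. complex_of_real (m $ i) * (c *\<^sub>R x) $ i $ j) =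
      of_real c * (\<Sum>i\<in>UNIV. complex_of_real (m $ i) * x $ i $ j)" for c j and x :: E3C
    by (simp add: sum_3 scaleR_conv_of_real[where 'a = complex] algebra_simps)
  then show ?thesis
    by (auto simp: subspace_def mem_reduced_space distrib_left sum.distrib
        simp del: vector_scaleR_component)
qed

lemma hermitian_diff_left: "hermitian (x - y) v = hermitian x v - hermitian y v"
  by (simp add: hermitian_def left_diff_distrib sum_subtractf)

text \<open>The orthogonal complement of the reduced space consists of the vectors \<open>(m\<^sub>i c)\<^sub>i\<close>; the
  correction is the one that makes the weighted sum vanish.\<close>

lemma
  assumes m: "\<And>i. m $ i > 0"
  shows orthogonal_projection_reduced: "orthogonal_projection (complexify_set (E_red m)) z =
    (\<chi> i j. z $ i $ j - complex_of_real (m $ i) *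
      ((\<Sum>k\<in>UNIV. of_real (m $ k) * z $ k $ j) / (\<Sum>k\<in>UNIV. (of_real (m $ k))\<^sup>2)))"
    (is "_ = ?w")
    and orthogonal_projection_in: "orthogonal_projection (complexify_set (E_red m)) z \<in> complexify_set (E_red m)"
proof -
  let ?S = "complexify_set (E_red m)"
  let ?N = "\<Sum>k\<in>UNIV. (complex_of_real (m $ k))\<^sup>2"
  have "(\<Sum>k\<in>UNIV. (m $ k)\<^sup>2) > 0" using m by (intro sum_pos) (auto simp: less_imp_neq[symmetric])
  moreover have "?N = of_real (\<Sum>k\<in>UNIV. (m $ k)\<^sup>2)" by simp
  ultimately have N: "?N \<noteq> 0" by (metis of_real_eq_0_iff less_irrefl)
  have wS: "?w \<in> ?S"
    unfolding mem_reduced_space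
  proof
    fix j
    let ?s = "\<Sum>k\<in>UNIV. complex_of_real (m $ k) * z $ k $ j"
    have "(\<Sum>i\<in>UNIV. complex_of_real (m $ i) * (z $ i $ j - of_real (m $ i) * c)) = ?s - ?N * c" for c
      by (simp add: sum_3 power2_eq_square algebra_simps)
    then have "(\<Sum>i\<in>UNIV. complex_of_real (m $ i) * ?w $ i $ j) = ?s - ?N * (?s / ?N)"
      by (simp only: vec_lambda_beta)
    also have "\<dots> = 0" using N by simp
    finally show "(\<Sum>i\<in>UNIV. complex_of_real (m $ i) * ?w $ i $ j) = 0" .
  qed
  have orth: "hermitian (z - ?w) v = 0" if v: "v \<in> ?S" for v
  proof -
    \<comment> \<open>Only the shape \<open>(m\<^sub>i C\<^sub>j)\<close> of the correction matters for orthogonality.\<close>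
    define C where "C = (\<lambda>j. (\<Sum>k\<in>UNIV. of_real (m $ k) * z $ k $ j) / ?N)"
    have "hermitian (z - ?w) v = hermitian (z - (\<chi> i j. z $ i $ j - complex_of_real (m $ i) * C j)) v"
      by (simp only: C_def)
    also have "\<dots> = (\<Sum>j\<in>UNIV. C j * cnj (\<Sum>i\<in>UNIV. complex_of_real (m $ i) * v $ i $ j))"
      by (simp add: hermitian_def sum_2 sum_3 algebra_simps)
    also have "\<dots> = 0" using v by (simp add: mem_reduced_space del: cnj_sum)
    finally show ?thesis .
  qed
  show "orthogonal_projection ?S z = ?w" unfolding orthogonal_projection_def
  proof (rule the_equality)
    show "?w \<in> ?S \<and> (\<forall>v\<in>?S. hermitian (z - ?w) v = 0)" using wS orth by blast
    fix w assume w: "w \<in> ?S \<and> (\<forall>v\<in>?S. hermitian (z - w) v = 0)"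
    have dS: "?w - w \<in> ?S"
      using wS w subspace_diff[OF subspace_reduced] by blast
    have "hermitian (?w - w) (?w - w) = hermitian (z - w) (?w - w) - hermitian (z - ?w) (?w - w)"
      unfolding hermitian_diff_left[symmetric] by simp
    also have "\<dots> = 0" using w orth dS by simp
    finally have "hermitian (?w - w) (?w - w) = 0" .
    then have "complex_of_real (\<Sum>i\<in>UNIV. \<Sum>j\<in>UNIV. (cmod ((?w - w) $ i $ j))\<^sup>2) = 0"
      unfolding hermitian_def of_real_sum complex_norm_square .
    then have "(\<Sum>i\<in>UNIV. \<Sum>j\<in>UNIV. (cmod ((?w - w) $ i $ j))\<^sup>2) = 0"
      unfolding of_real_eq_0_iff .
    then have "\<forall>i j. (?w - w) $ i $ j = 0"
      by (simp add: sum_nonneg_eq_0_iff sum_nonneg del: vector_minus_component)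
    then have "?w - w = 0" by (simp add: vec_eq_iff)
    then show "w = ?w" by simp
  qed
  with wS show "orthogonal_projection ?S z \<in> ?S" by simp
qed


section \<open>The linear system of an equilateral triangle\<close>

text \<open>The type of three indices is the ring of integers modulo 3, so \<open>k + 1\<close> and \<open>k + 2\<close> are the two
  vertices following \<open>k\<close> cyclically; these rules reduce the values that occur.\<close>

lemma Z3_numerals: "(4 :: 3) = 1" "(5 :: 3) = 2"
  by simp_all

text \<open>The vectors \<open>(x\<^sub>k, y\<^sub>k)\<close> are the unit edges \<open>e\<^sub>k\<close> of an equilateral triangle and
  \<open>(U\<^sub>k, V\<^sub>k)\<close> the differences \<open>W\<^sub>k\<close>. Eliminating the tangential parts from the equations along
  \<open>e\<^sub>k\<close> instead would introduce a spurious factor \<open>l\<^sup>2 - 4\<close>, since summing the equations yields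
  \<open>\<Sum>\<^sub>k W\<^sub>k = 0\<close> only for \<open>l\<^sup>2 \<noteq> 4\<close>. Using that constraint from the start avoids the factor, and
  treats \<open>l = 0\<close> together with the other values when \<open>S = 0\<close> is derived.\<close>

lemma triangle_equations_solution:
  fixes x y U V \<mu> :: "3 \<Rightarrow> complex" and l g :: complex
  defines "s \<equiv> \<lambda>k. x k * U k + y k * V k"
  defines "S1 \<equiv> \<Sum>k\<in>UNIV. s k * x k" and "S2 \<equiv> \<Sum>k\<in>UNIV. s k * y k"
  assumes unit: "\<And>k. (x k)\<^sup>2 + (y k)\<^sup>2 = 1"
    and closed: "(\<Sum>k\<in>UNIV. x k) = 0" "(\<Sum>k\<in>UNIV. y k) = 0"
    and mu: "(\<Sum>k\<in>UNIV. \<mu> k) = 1"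
    and sum0: "(\<Sum>k\<in>UNIV. U k) = 0" "(\<Sum>k\<in>UNIV. V k) = 0"
    and E1: "\<And>k. l\<^sup>2 * U k + 2 * \<i> * l * V k + g * (s k * x k - \<mu> k * S1) = 0"
    and E2: "\<And>k. l\<^sup>2 * V k - 2 * \<i> * l * U k + g * (s k * y k - \<mu> k * S2) = 0"
    and det: "l ^ 4 + (g - 4) * l\<^sup>2 + g\<^sup>2 * (3 / 4 * (\<mu> 1 * \<mu> 2 + \<mu> 1 * \<mu> 3 + \<mu> 2 * \<mu> 3)) \<noteq> 0"
    and homographic: "l \<noteq> 0 \<Longrightarrow> l\<^sup>2 \<noteq> 4 - g" and g: "g \<noteq> 0"
  shows "\<exists>c. (l \<noteq> 0 \<longrightarrow> c = 0) \<and> (\<forall>k. U k = - c * y k \<and> V k = c * x k)"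
proof -
  \<comment> \<open>\<open>s\<close> and \<open>t\<close> are the coordinates of \<open>W\<^sub>k\<close> in the basis \<open>e\<^sub>k, J e\<^sub>k\<close>;
    \<open>p, q, r\<close> are the entries of \<open>A = \<Sum>\<^sub>k \<mu>\<^sub>k e\<^sub>k e\<^sub>k\<^sup>T\<close>.\<close>
  define t where "t = (\<lambda>k. x k * V k - y k * U k)"
  define p q r where "p = (\<Sum>k\<in>UNIV. \<mu> k * (x k)\<^sup>2)" and "q = (\<Sum>k\<in>UNIV. \<mu> k * (x k * y k))"
    and "r = (\<Sum>k\<in>UNIV. \<mu> k * (y k)\<^sup>2)"
  have U: "U k = s k * x k - t k * y k" and V: "V k = s k * y k + t k * x k" for k
  proof -
    have "s k * x k - t k * y k = ((x k)\<^sup>2 + (y k)\<^sup>2) * U k"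
      "s k * y k + t k * x k = ((x k)\<^sup>2 + (y k)\<^sup>2) * V k"
      by (simp_all add: s_def t_def power2_eq_square algebra_simps)
    then show "U k = s k * x k - t k * y k" "V k = s k * y k + t k * x k"
      by (simp_all add: unit)
  qed
  have x3: "x 3 = - x 1 - x 2" and y3: "y 3 = - y 1 - y 2"
    using closed by (simp_all add: sum_3 algebra_simps add_eq_0_iff)
  have dot: "2 * (x 1 * x 2 + y 1 * y 2) = -1"
  proof -
    have "2 * (x 1 * x 2 + y 1 * y 2) =
        ((x 3)\<^sup>2 + (y 3)\<^sup>2) - ((x 1)\<^sup>2 + (y 1)\<^sup>2) - ((x 2)\<^sup>2 + (y 2)\<^sup>2)"
      by (simp add: x3 y3 power2_eq_square algebra_simps)
    then show ?thesis by (simp add: unit)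
  qed
  have cross: "4 * (x 1 * y 2 - x 2 * y 1)\<^sup>2 = 3"
  proof -
    have "4 * (x 1 * y 2 - x 2 * y 1)\<^sup>2 = 4 * (((x 1)\<^sup>2 + (y 1)\<^sup>2) * ((x 2)\<^sup>2 + (y 2)\<^sup>2))
        - (2 * (x 1 * x 2 + y 1 * y 2))\<^sup>2"
      by (simp add: power2_eq_square algebra_simps)
    then show ?thesis by (simp only: unit dot) simp
  qed
  have trace: "p + r = 1"
  proof -
    have "p + r = (\<Sum>k\<in>UNIV. \<mu> k * ((x k)\<^sup>2 + (y k)\<^sup>2))"
      by (simp add: p_def r_def distrib_left sum.distrib)
    then show ?thesis by (simp add: unit mu)
  qed
  have pr: "p * r - q\<^sup>2 = 3 / 4 * (\<mu> 1 * \<mu> 2 + \<mu> 1 * \<mu> 3 + \<mu> 2 * \<mu> 3)"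
  proof -
    have "p * r - q\<^sup>2 = (x 1 * y 2 - x 2 * y 1)\<^sup>2 * (\<mu> 1 * \<mu> 2 + \<mu> 1 * \<mu> 3 + \<mu> 2 * \<mu> 3)"
      by (simp add: p_def q_def r_def sum_3 x3 y3 power2_eq_square algebra_simps)
    moreover have "(x 1 * y 2 - x 2 * y 1)\<^sup>2 = 3 / 4" using cross by (simp add: mult.commute)
    ultimately show ?thesis by simp
  qed
  define T1 T2 where "T1 = (\<Sum>k\<in>UNIV. t k * x k)" and "T2 = (\<Sum>k\<in>UNIV. t k * y k)"
  have T: "T2 = S1" "T1 = - S2"
    using sum0 unfolding U V
    by (simp_all add: T1_def T2_def S1_def S2_def sum_subtractf sum.distrib add_eq_0_iff)
  \<comment> \<open>The component along \<open>J e\<^sub>k\<close>, where the term \<open>g s\<^sub>k e\<^sub>k\<close> drops out.\<close>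
  have Et: "l\<^sup>2 * t k - 2 * \<i> * l * s k + g * \<mu> k * (y k * S1 - x k * S2) = 0" for k
  proof -
    have "l\<^sup>2 * t k - 2 * \<i> * l * s k + g * \<mu> k * (y k * S1 - x k * S2) =
        x k * (l\<^sup>2 * V k - 2 * \<i> * l * U k + g * (s k * y k - \<mu> k * S2))
        - y k * (l\<^sup>2 * U k + 2 * \<i> * l * V k + g * (s k * x k - \<mu> k * S1))"
      by (simp add: t_def s_def power2_eq_square algebra_simps)
    then show ?thesis by (simp only: E1 E2) simp
  qed
  have A: "l\<^sup>2 * T1 - 2 * \<i> * l * S1 + g * (q * S1 - p * S2) = 0"
  proof -
    have "(\<Sum>k\<in>UNIV. x k * (l\<^sup>2 * t k - 2 * \<i> * l * s k + g * \<mu> k * (y k * c1 - x k * c2))) =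
        l\<^sup>2 * T1 - 2 * \<i> * l * (\<Sum>k\<in>UNIV. s k * x k) + g * (q * c1 - p * c2)" for c1 c2
      by (simp add: T1_def p_def q_def sum_3 power2_eq_square algebra_simps)
    from this[of S1 S2] show ?thesis by (simp add: Et flip: S1_def)
  qed
  have B: "l\<^sup>2 * T2 - 2 * \<i> * l * S2 + g * (r * S1 - q * S2) = 0"
  proof -
    have "(\<Sum>k\<in>UNIV. y k * (l\<^sup>2 * t k - 2 * \<i> * l * s k + g * \<mu> k * (y k * c1 - x k * c2))) =
        l\<^sup>2 * T2 - 2 * \<i> * l * (\<Sum>k\<in>UNIV. s k * y k) + g * (r * c1 - q * c2)" for c1 c2
      by (simp add: T2_def r_def q_def sum_3 power2_eq_square algebra_simps)
    from this[of S1 S2] show ?thesis by (simp add: Et flip: S2_def)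
  qed
  \<comment> \<open>With \<open>T = J S\<close>, \<open>A\<close> and \<open>B\<close> are two linear equations for \<open>S\<close>, and \<open>D\<close> is their determinant;
    \<open>D * S1\<close> and \<open>D * S2\<close> come from Cramer's rule.\<close>
  define D where "D = l ^ 4 + (g - 4) * l\<^sup>2 + g\<^sup>2 * (p * r - q\<^sup>2)"
  have D: "D \<noteq> 0" using det by (simp add: D_def pr)
  have r: "r = 1 - p" using trace by (simp add: algebra_simps)
  have "D * S1 = (l\<^sup>2 + g * p) * (l\<^sup>2 * T2 - 2 * \<i> * l * S2 + g * (r * S1 - q * S2))
      - (g * q + 2 * \<i> * l) * (l\<^sup>2 * T1 - 2 * \<i> * l * S1 + g * (q * S1 - p * S2))"
    by (simp add: D_def T r power2_eq_square power4_eq_xxxx algebra_simps)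
  moreover have "D * S2 = (g * q - 2 * \<i> * l) * (l\<^sup>2 * T2 - 2 * \<i> * l * S2 + g * (r * S1 - q * S2))
      - (l\<^sup>2 + g * r) * (l\<^sup>2 * T1 - 2 * \<i> * l * S1 + g * (q * S1 - p * S2))"
    by (simp add: D_def T r power2_eq_square power4_eq_xxxx algebra_simps)
  ultimately have "D * S1 = 0" "D * S2 = 0" by (simp_all only: A B) simp_all
  with D have S: "S1 = 0" "S2 = 0" by simp_all
  have Es: "(l\<^sup>2 + g) * s k + 2 * \<i> * l * t k = 0" for k
  proof -
    have "l\<^sup>2 * s k + 2 * \<i> * l * t k + g * s k * ((x k)\<^sup>2 + (y k)\<^sup>2) =
        x k * (l\<^sup>2 * U k + 2 * \<i> * l * V k + g * (s k * x k - \<mu> k * S1))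
        + y k * (l\<^sup>2 * V k - 2 * \<i> * l * U k + g * (s k * y k - \<mu> k * S2))"
      by (simp add: t_def s_def S power2_eq_square algebra_simps)
    also have "\<dots> = 0" by (simp only: E1 E2) simp
    finally show ?thesis by (simp add: unit algebra_simps)
  qed
  have s0: "s k = 0" and lt: "l * t k = 0" for k
  proof -
    have "s k = 0 \<and> l * t k = 0"
    proof (cases "l = 0")
      case True then show ?thesis using Es[of k] g by simp
    next
      case False
      have *: "l * (l * t k - 2 * \<i> * s k) = 0" using Et[of k] S by (simp add: power2_eq_square algebra_simps)
      then have "l * t k = 2 * \<i> * s k" using False by simp
      moreover have "(l\<^sup>2 - (4 - g)) * s k =
          ((l\<^sup>2 + g) * s k + 2 * \<i> * l * t k) - 2 * \<i> * (l * t k - 2 * \<i> * s k)"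
        by (simp add: algebra_simps)
      ultimately have "(l\<^sup>2 - (4 - g)) * s k = 0" by (simp only: Es) simp
      then show ?thesis using homographic[OF False] * False by auto
    qed
    then show "s k = 0" "l * t k = 0" by auto
  qed
  \<comment> \<open>\<open>\<Sum>\<^sub>k t\<^sub>k e\<^sub>k = 0\<close>, and \<open>e\<^sub>1 + e\<^sub>2 + e\<^sub>3 = 0\<close> is the only relation between the edges.\<close>
  have "(x 1 * y 2 - x 2 * y 1) \<noteq> 0" using cross by auto
  moreover have "(x 1 * y 2 - x 2 * y 1) * (t 1 - t 3) = 0" "(x 1 * y 2 - x 2 * y 1) * (t 2 - t 3) = 0"
  proof -
    have "(t 1 - t 3) * x 1 + (t 2 - t 3) * x 2 = 0" "(t 1 - t 3) * y 1 + (t 2 - t 3) * y 2 = 0"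
      using T unfolding S T1_def T2_def sum_3 x3 y3 by (simp_all add: algebra_simps)
    then have "y 2 * ((t 1 - t 3) * x 1 + (t 2 - t 3) * x 2) - x 2 * ((t 1 - t 3) * y 1 + (t 2 - t 3) * y 2) = 0"
      "x 1 * ((t 1 - t 3) * y 1 + (t 2 - t 3) * y 2) - y 1 * ((t 1 - t 3) * x 1 + (t 2 - t 3) * x 2) = 0"
      by simp_all
    then show "(x 1 * y 2 - x 2 * y 1) * (t 1 - t 3) = 0" "(x 1 * y 2 - x 2 * y 1) * (t 2 - t 3) = 0"
      by (simp_all add: algebra_simps)
  qed
  ultimately have t: "t k = t 3" for k using exhaust_3[of k] by auto
  have "U k = - t 3 * y k \<and> V k = t 3 * x k" for k
    using U[of k] V[of k] s0[of k] t[of k] by simp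
  moreover have "l \<noteq> 0 \<longrightarrow> t 3 = 0" using lt[of 3] by auto
  ultimately show ?thesis by blast
qed

section \<open>Linearity of complexified operators\<close>

lemma linear_E3C_maps:
  "linear of_E3" "linear Re3" "linear Im3" "linear (cscale c)"
  by (auto intro!: linearI simp: of_E3_def Re3_def Im3_def cscale_def vec_eq_iff complex_eq_iff algebra_simps)

lemma linear_complexify_op:
  assumes "linear T" shows "linear (complexify_op T)"
proof -
  note c = linear_compose[unfolded o_def]
  have "linear (\<lambda>z. of_E3 (T (Re3 z)) + cscale \<i> (of_E3 (T (Im3 z))))"
    by (intro linear_compose_add c[OF _ linear_E3C_maps(1)] c[OF _ linear_E3C_maps(4)]
        c[OF _ assms] linear_E3C_maps)
  then show ?thesis by (simp add: complexify_op_def[abs_def])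
qed

lemma linear_J3: "linear J3"
  by (rule linearI) (simp_all add: J3_def vec_eq_iff matrix_vector_right_distrib matrix_vector_mult_scaleR)

lemma bij_betw_subspaceI:
  fixes f :: "'a::euclidean_space \<Rightarrow> 'a"
  assumes f: "linear f" and S: "subspace S" and into: "f ` S \<subseteq> S"
    and ker: "\<And>x. x \<in> S \<Longrightarrow> f x = 0 \<Longrightarrow> x = 0"
  shows "bij_betw f S S"
proof -
  have inj: "inj_on f S"
    using ker linear_inj_on_iff_eq_0[OF f S] by blast
  then have "dim (f ` S) = dim S"
    using dim_image_eq[OF f] S by (metis span_eq_iff)
  then have "f ` S = S"
    using subspace_dim_equal[OF linear_subspace_image[OF f S] S into] by simp
  with inj show ?thesis by (simp add: bij_betw_def)
qed


section \<open>The kernel at the Lagrange configuration\<close>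

lemma J_mult_nth [simp]: "(J *v v) $ 1 = - (v $ 2)" "(J *v v) $ 2 = v $ 1"
  by (simp_all add: J_def matrix_vector_mult_def sum_2)

text \<open>The complex-bilinear (not sesquilinear) extension of the real inner product, as it arises when a
  real operator is complexified.\<close>

definition cdot :: "E \<Rightarrow> complex ^ 2 \<Rightarrow> complex"
  where "cdot e w = of_real (e $ 1) * w $ 1 + of_real (e $ 2) * w $ 2"

text \<open>\<open>P i j\<close> will be a component of \<open>\<langle>e\<^sub>i\<^sub>j, w\<^sub>i - w\<^sub>j\<rangle> e\<^sub>i\<^sub>j\<close>, which changes sign when the bodies are
  exchanged. The identity turns the difference of the equations of two bodies into an equation in
  which only their own side and the cyclic sum over all sides appear.\<close>

lemma cyclic_difference:
  fixes P :: "3 \<Rightarrow> 3 \<Rightarrow> complex"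
  assumes antisym: "\<And>i j. P i j = - P j i" and mu: "(\<Sum>k\<in>UNIV. \<mu> k) = 1"
  shows "(\<Sum>j\<in>UNIV. \<mu> j * P (k + 1) j) - (\<Sum>j\<in>UNIV. \<mu> j * P (k + 2) j) =
    P (k + 1) (k + 2) - \<mu> k * (\<Sum>n\<in>UNIV. P (n + 1) (n + 2))"
proof -
  have m3: "\<mu> 3 = 1 - \<mu> 1 - \<mu> 2" using mu by (simp add: sum_3 algebra_simps)
  have diag: "P i i = 0" for i using antisym[of i i] by simp
  show ?thesis
    using exhaust_3[of k]
    by (auto simp: sum_3 Z3_numerals diag antisym[of 2 1] antisym[of 3 1] antisym[of 3 2] m3 algebra_simps)
qed

locale lagrange_triangle =
  fixes m :: "real ^ 3" and \<alpha> :: real and \<phi> :: "real \<Rightarrow> real" and a :: E3 and d :: real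
  assumes mass: "\<And>i. m $ i > 0" and alpha: "\<alpha> \<ge> 1" and pot: "is_pair_potential \<alpha> \<phi>"
    and centred: "a \<in> E_red m"
    and d: "d > 0" "d powr (\<alpha> + 1) = m $ 1 + m $ 2 + m $ 3"
    and sides: "norm (a $ 1 - a $ 2) = d" "norm (a $ 1 - a $ 3) = d" "norm (a $ 2 - a $ 3) = d"
begin

abbreviation total :: real where "total \<equiv> m $ 1 + m $ 2 + m $ 3"

abbreviation Ered :: "E3C set" where "Ered \<equiv> complexify_set (E_red m)"

abbreviation hess :: "E3 \<Rightarrow> E3" where "hess \<equiv> hessian (amended_potential m \<phi>) a"

definition edge :: "3 \<Rightarrow> 3 \<Rightarrow> E" where "edge i j = (1 / d) *\<^sub>R (a $ i - a $ j)"

lemma total_pos: "total > 0"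
  using mass[of 1] mass[of 2] mass[of 3] by simp

lemma side: "i \<noteq> j \<Longrightarrow> norm (a $ i - a $ j) = d"
  using exhaust_3[of i] exhaust_3[of j] sides by (auto simp: norm_minus_commute)

lemma edge_refl [simp]: "edge i i = 0"
  by (simp add: edge_def)

lemma edge_swap: "edge i j = - edge j i"
  by (simp add: edge_def algebra_simps)

lemma edge_unit: "i \<noteq> j \<Longrightarrow> (edge i j $ 1)\<^sup>2 + (edge i j $ 2)\<^sup>2 = 1"
proof -
  assume "i \<noteq> j"
  then have "norm (edge i j) = 1" using d side by (simp add: edge_def)
  then show ?thesis
    by (simp add: norm_vec_def L2_set_def sum_2)
qed

lemma a_noncollision: "a \<in> noncollision"
  using sides d by (auto simp: noncollision_def)

lemma pair_force_deriv_edge: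
  assumes "i \<noteq> j"
  shows "pair_force_deriv \<alpha> (a $ i - a $ j) h =
    (1 / total) *\<^sub>R (h - ((\<alpha> + 1) * (edge i j \<bullet> h)) *\<^sub>R edge i j)"
proof -
  have "a $ i - a $ j = d *\<^sub>R edge i j" using d by (simp add: edge_def)
  moreover have "norm (a $ i - a $ j) = d" using side assms .
  moreover have "d powr (- (\<alpha> + 1)) = 1 / total"
    using d by (simp only: powr_minus_divide)
  ultimately show ?thesis
    using d by (simp add: pair_force_deriv_def power2_eq_square)
qed

text \<open>Each pair contributes \<open>(m\<^sub>i m\<^sub>j / M) (w\<^sub>i - w\<^sub>j)\<close> to its isotropic part. Summed over \<open>j\<close> these
  equal \<open>m\<^sub>i w\<^sub>i\<close> for a centred \<open>w\<close>, which cancels the mass term.\<close>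

lemma hess_reduced:
  assumes w: "w \<in> E_red m"
  shows "hess w $ i = ((\<alpha> + 1) * m $ i / total) *\<^sub>R
    (\<Sum>j\<in>UNIV. (m $ j * (edge i j \<bullet> (w $ i - w $ j))) *\<^sub>R edge i j)"
proof -
  define F where "F i j = (edge i j \<bullet> (w $ i - w $ j)) *\<^sub>R edge i j" for i j
  have sym: "F j i = - F i j" for i j
    unfolding F_def edge_swap[of j i] by (simp add: inner_diff_right algebra_simps)
  \<comment> \<open>\<open>G i j\<close> is the linearised force between \<open>i\<close> and \<open>j\<close>; its antisymmetry lets the sum over
    unordered pairs be written as a full sum over \<open>j\<close> for each body \<open>i\<close>.\<close>
  define G where "G i j = (m $ i * m $ j / total) *\<^sub>R ((w $ i - w $ j) - (\<alpha> + 1) *\<^sub>R F i j)" for i j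
  have G: "G j i = - G i j" for i j
    by (simp add: G_def sym[of j i] algebra_simps)
  have G0: "G i i = 0" for i by (simp add: G_def F_def)
  have pf: "pair_force_deriv \<alpha> (a $ i - a $ j) (w $ i - w $ j) =
      (1 / total) *\<^sub>R ((w $ i - w $ j) - (\<alpha> + 1) *\<^sub>R F i j)" if "i \<noteq> j" for i j
    using that by (simp add: pair_force_deriv_edge F_def)
  have opp: "(m $ i * m $ j) *\<^sub>R opposite i j (pair_force_deriv \<alpha> (a $ i - a $ j) (w $ i - w $ j)) =
      opposite i j (G i j)" if "i \<noteq> j" for i j
    using that by (simp add: pf G_def opposite_def axis_def vec_eq_iff algebra_simps)
  have "hess w = mass_op m w - (opposite 1 2 (G 1 2) + (opposite 1 3 (G 1 3) + opposite 2 3 (G 2 3)))"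
    by (simp add: hessian_amended_potential[OF mass pot a_noncollision] potential_hessian_def opp)
  then have "hess w $ i = m $ i *\<^sub>R w $ i - (\<Sum>j\<in>UNIV. G i j)"
    using exhaust_3[of i] G[of 1 2] G[of 1 3] G[of 2 3] G0
    by (auto simp: opposite_def axis_def diag_op_def sum_3)
  also have "(\<Sum>j\<in>UNIV. G i j) = (m $ i / total) *\<^sub>R
      (total *\<^sub>R w $ i - (\<Sum>j\<in>UNIV. m $ j *\<^sub>R w $ j) - (\<alpha> + 1) *\<^sub>R (\<Sum>j\<in>UNIV. m $ j *\<^sub>R F i j))"
    by (simp add: G_def sum_3 scaleR_diff_right scaleR_add_right algebra_simps add_divide_distrib)
  also have "\<dots> = m $ i *\<^sub>R w $ i - ((\<alpha> + 1) * m $ i / total) *\<^sub>R (\<Sum>j\<in>UNIV. m $ j *\<^sub>R F i j)"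
    using w total_pos by (simp add: E_red_def scaleR_diff_right)
  finally show ?thesis by (simp add: F_def)
qed

lemma hess_reduced_nth:
  assumes w: "w \<in> E_red m"
  shows "hess w $ i $ k = m $ i * ((\<alpha> + 1) *
    (\<Sum>j\<in>UNIV. (m $ j / total) * ((edge i j \<bullet> (w $ i - w $ j)) * edge i j $ k)))"
  unfolding hess_reduced[OF w] vector_scaleR_component sum_component sum_distrib_left real_scaleR_def
  by (intro sum.cong refl) simp

lemma Re_cdot: "Re (cdot e (z $ i - z $ j)) = e \<bullet> (Re3 z $ i - Re3 z $ j)"
  and Im_cdot: "Im (cdot e (z $ i - z $ j)) = e \<bullet> (Im3 z $ i - Im3 z $ j)"
  by (simp_all add: cdot_def inner_vec_def sum_2 Re3_def Im3_def)

lemma complexify_hess: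
  assumes z: "z \<in> Ered"
  shows "complexify_op hess z $ i $ k = of_real (m $ i) * (of_real (\<alpha> + 1) *
    (\<Sum>j\<in>UNIV. of_real (m $ j / total) * (cdot (edge i j) (z $ i - z $ j) * of_real (edge i j $ k))))"
proof -
  have z': "Re3 z \<in> E_red m" "Im3 z \<in> E_red m" using z by (auto simp: complexify_set_def)
  show ?thesis
    unfolding complexify_op_def
    by (simp add: complex_eq_iff of_E3_def cscale_def hess_reduced_nth[OF z'(1)] hess_reduced_nth[OF z'(2)]
       Re_cdot Im_cdot del: of_real_add of_real_divide)
qed

lemma M_op_nth:
  assumes z: "z \<in> Ered"
  shows "M_op m \<phi> a \<mu> z $ i $ 1 = of_real (m $ i) * (\<mu>\<^sup>2 * z $ i $ 1 + 2 * \<i> * \<mu> * z $ i $ 2 +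
      of_real (\<alpha> + 1) * (\<Sum>j\<in>UNIV. of_real (m $ j / total) *
        (cdot (edge i j) (z $ i - z $ j) * of_real (edge i j $ 1))))"
    and "M_op m \<phi> a \<mu> z $ i $ 2 = of_real (m $ i) * (\<mu>\<^sup>2 * z $ i $ 2 - 2 * \<i> * \<mu> * z $ i $ 1 +
      of_real (\<alpha> + 1) * (\<Sum>j\<in>UNIV. of_real (m $ j / total) *
        (cdot (edge i j) (z $ i - z $ j) * of_real (edge i j $ 2))))"
proof -
  have c1: "complexify_op (mass_op m) z $ i $ k = of_real (m $ i) * z $ i $ k" for k
    by (simp add: complexify_op_def of_E3_def cscale_def diag_op_def Re3_def Im3_def complex_eq_iff)
  have c2: "complexify_op (mass_op m \<circ> J3) z $ i $ 1 = - of_real (m $ i) * z $ i $ 2"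
     "complexify_op (mass_op m \<circ> J3) z $ i $ 2 = of_real (m $ i) * z $ i $ 1"
    by (simp_all add: complexify_op_def of_E3_def cscale_def diag_op_def J3_def Re3_def Im3_def complex_eq_iff)
  show "M_op m \<phi> a \<mu> z $ i $ 1 = of_real (m $ i) * (\<mu>\<^sup>2 * z $ i $ 1 + 2 * \<i> * \<mu> * z $ i $ 2 +
      of_real (\<alpha> + 1) * (\<Sum>j\<in>UNIV. of_real (m $ j / total) *
        (cdot (edge i j) (z $ i - z $ j) * of_real (edge i j $ 1))))"
    unfolding M_op_def
    by (simp only: vector_add_component vector_minus_component cscale_def vec_lambda_beta
        c1 c2 complexify_hess[OF z]) (simp add: algebra_simps del: of_real_add of_real_divide)
  show "M_op m \<phi> a \<mu> z $ i $ 2 = of_real (m $ i) * (\<mu>\<^sup>2 * z $ i $ 2 - 2 * \<i> * \<mu> * z $ i $ 1 +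
      of_real (\<alpha> + 1) * (\<Sum>j\<in>UNIV. of_real (m $ j / total) *
        (cdot (edge i j) (z $ i - z $ j) * of_real (edge i j $ 2))))"
    unfolding M_op_def
    by (simp only: vector_add_component vector_minus_component cscale_def vec_lambda_beta
        c1 c2 complexify_hess[OF z]) (simp add: algebra_simps del: of_real_add of_real_divide)
qed


lemma J3_a_reduced: "cscale c (of_E3 (J3 a)) \<in> Ered"
proof -
  have "(\<Sum>i\<in>UNIV. m $ i * a $ i $ k) = 0" for k
    using centred by (simp add: E_red_def vec_eq_iff)
  then have a0: "(\<Sum>i\<in>UNIV. complex_of_real (m $ i) * of_real (a $ i $ k)) = 0" for k
    by (metis (no_types, lifting) of_real_0 of_real_mult of_real_sum sum.cong)
  have "(\<Sum>i\<in>UNIV. complex_of_real (m $ i) * cscale c (of_E3 (J3 a)) $ i $ 1) =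
      - c * (\<Sum>i\<in>UNIV. complex_of_real (m $ i) * of_real (a $ i $ 2))"
    "(\<Sum>i\<in>UNIV. complex_of_real (m $ i) * cscale c (of_E3 (J3 a)) $ i $ 2) =
      c * (\<Sum>i\<in>UNIV. complex_of_real (m $ i) * of_real (a $ i $ 1))"
    by (simp_all add: cscale_def of_E3_def J3_def sum_3 algebra_simps)
  then show ?thesis
    unfolding mem_reduced_space by (simp only: forall_2 a0) simp
qed

text \<open>If the projection of \<open>y = M\<^sub>a(\<mu>) z\<close> vanishes, then \<open>y\<^sub>i = m\<^sub>i c\<close>. The components of \<open>y\<close> sum to zero:
  the kinetic and Coriolis terms because \<open>z\<close> is centred, the force terms by antisymmetry. As the total
  mass is positive, \<open>c = 0\<close>.\<close>

lemma PM_op_eq_0_iff: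
  assumes z: "z \<in> Ered"
  shows "PM_op m \<phi> a \<mu> z = 0 \<longleftrightarrow> M_op m \<phi> a \<mu> z = 0"
proof
  let ?y = "M_op m \<phi> a \<mu> z"
  have momentum: "(\<Sum>i\<in>UNIV. ?y $ i $ k) = 0" for k
  proof -
    have z0: "(\<Sum>i\<in>UNIV. of_real (m $ i) * z $ i $ k) = 0" for k
      using z by (simp add: mem_reduced_space)
    define P where "P k i j = cdot (edge i j) (z $ i - z $ j) * of_real (edge i j $ k)" for k i j
    have P: "P k j i = - P k i j" for k i j
      unfolding P_def edge_swap[of j i] by (simp add: cdot_def algebra_simps)
    have diag: "P k i i = 0" for k i by (simp add: P_def)
    have "(\<Sum>i\<in>UNIV. of_real (m $ i) * (\<Sum>j\<in>UNIV. of_real (m $ j / total) * P k i j)) = 0" for k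
      by (simp add: sum_3 diag P[of k 1 2] P[of k 1 3] P[of k 2 3] algebra_simps)
    then have P0: "(\<Sum>i\<in>UNIV. of_real (m $ i) * (c * (\<Sum>j\<in>UNIV. of_real (m $ j / total) * P k i j))) = 0" for c k
      by (simp add: mult.left_commute[of _ c] flip: sum_distrib_left)
    have "(\<Sum>i\<in>UNIV. ?y $ i $ 1) = \<mu>\<^sup>2 * (\<Sum>i\<in>UNIV. of_real (m $ i) * z $ i $ 1)
      + 2 * \<i> * \<mu> * (\<Sum>i\<in>UNIV. of_real (m $ i) * z $ i $ 2)
      + (\<Sum>i\<in>UNIV. of_real (m $ i) * (of_real (\<alpha> + 1) * (\<Sum>j\<in>UNIV. of_real (m $ j / total) * P 1 i j)))"
      unfolding M_op_nth[OF z] P_def by (simp only: sum_distrib_left distrib_left sum.distrib mult_ac)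
    moreover have "(\<Sum>i\<in>UNIV. ?y $ i $ 2) = \<mu>\<^sup>2 * (\<Sum>i\<in>UNIV. of_real (m $ i) * z $ i $ 2)
      - 2 * \<i> * \<mu> * (\<Sum>i\<in>UNIV. of_real (m $ i) * z $ i $ 1)
      + (\<Sum>i\<in>UNIV. of_real (m $ i) * (of_real (\<alpha> + 1) * (\<Sum>j\<in>UNIV. of_real (m $ j / total) * P 2 i j)))"
      unfolding M_op_nth[OF z] P_def
      by (simp only: sum_distrib_left distrib_left right_diff_distrib sum.distrib sum_subtractf mult_ac)
    ultimately show ?thesis using exhaust_2[of k] by (auto simp only: z0 P0) simp_all
  qed
  assume "PM_op m \<phi> a \<mu> z = 0"
  then have proj0: "orthogonal_projection Ered ?y $ i $ k = 0" for i k by (simp add: PM_op_def)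
  have y: "?y $ i $ k = of_real (m $ i) *
      ((\<Sum>n\<in>UNIV. of_real (m $ n) * ?y $ n $ k) / (\<Sum>n\<in>UNIV. (of_real (m $ n))\<^sup>2))" for i k
    using proj0[of i k]
    unfolding orthogonal_projection_reduced[OF mass] vec_lambda_beta right_minus_eq .
  define c where "c k = (\<Sum>n\<in>UNIV. of_real (m $ n) * ?y $ n $ k) / (\<Sum>n\<in>UNIV. (complex_of_real (m $ n))\<^sup>2)" for k
  have y': "?y $ i $ k = of_real (m $ i) * c k" for i k
    unfolding c_def by (rule y)
  have "of_real total * c k = 0" for k
    using momentum[of k] unfolding y' by (simp add: sum_3 algebra_simps)
  then have "c k = 0" for k
    using total_pos by (metis mult_eq_0_iff of_real_eq_0_iff less_irrefl)
  then show "?y = 0" using y' by (simp add: vec_eq_iff)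
next
  assume "M_op m \<phi> a \<mu> z = 0"
  then show "PM_op m \<phi> a \<mu> z = 0"
    unfolding PM_op_def orthogonal_projection_reduced[OF mass] by (simp add: vec_eq_iff)
qed

lemma linear_PM_op: "linear (PM_op m \<phi> a \<mu>)"
proof -
  have proj: "linear (orthogonal_projection Ered)"
    unfolding orthogonal_projection_reduced[OF mass, abs_def]
    by (rule linearI)
      (simp_all add: vec_eq_iff sum_3 scaleR_conv_of_real[where 'a = complex] add_divide_distrib algebra_simps)
  have "linear (mass_op m)"
    using bounded_linear_diag_op by (rule bounded_linear.linear)
  note lin = linear_complexify_op[OF this] linear_complexify_op[OF linear_compose[OF linear_J3 this]]
    linear_complexify_op[OF linear_hessian[OF mass pot a_noncollision]]
  note sc = linear_compose[OF _ linear_E3C_maps(4), unfolded o_def]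
  have "linear (M_op m \<phi> a \<mu>)"
    unfolding M_op_def[abs_def]
    by (intro linear_compose_add linear_compose_sub sc lin)
  from linear_compose[OF this proj] show ?thesis
    by (simp add: PM_op_def[abs_def] o_def)
qed

lemma PM_op_in_reduced: "PM_op m \<phi> a \<mu> z \<in> Ered"
  unfolding PM_op_def by (rule orthogonal_projection_in[OF mass])

text \<open>After passing to differences of consecutive bodies the solution is \<open>W\<^sub>k = c J e\<^sub>k\<close>. So \<open>z\<close> and
  \<open>(c / d) J\<^sub>3 a\<close> have the same differences, and both are centred, which makes them equal.\<close>

lemma M_op_kernel:
  assumes z: "z \<in> Ered" and ker: "M_op m \<phi> a (of_real l) z = 0"
    and homographic: "l \<noteq> 0 \<Longrightarrow> l\<^sup>2 \<noteq> 3 - \<alpha>"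
    and beta: "beta m > 9 * ((3 - \<alpha>) / (1 + \<alpha>))\<^sup>2"
  shows "\<exists>c. (l \<noteq> 0 \<longrightarrow> c = 0) \<and> z = cscale c (of_E3 (J3 a))"
proof -
  define P where "P k i j = cdot (edge i j) (z $ i - z $ j) * of_real (edge i j $ k)" for k i j
  have P: "P k i j = - P k j i" for k i j
    unfolding P_def edge_swap[of i j] by (simp add: cdot_def algebra_simps)
  define \<nu> where "\<nu> k = complex_of_real (m $ k / total)" for k
  have nu: "(\<Sum>k\<in>UNIV. \<nu> k) = 1"
    using total_pos by (simp add: \<nu>_def sum_3 flip: of_real_add add_divide_distrib)
  define L where "L = complex_of_real l"
  define g where "g = complex_of_real (\<alpha> + 1)"
  have F: "L\<^sup>2 * z $ i $ 1 + 2 * \<i> * L * z $ i $ 2 + g * (\<Sum>j\<in>UNIV. \<nu> j * P 1 i j) = 0"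
    "L\<^sup>2 * z $ i $ 2 - 2 * \<i> * L * z $ i $ 1 + g * (\<Sum>j\<in>UNIV. \<nu> j * P 2 i j) = 0" for i
  proof -
    have "M_op m \<phi> a L z $ i $ k = 0" for k using ker by (simp add: L_def)
    from this[of 1] this[of 2] show
      "L\<^sup>2 * z $ i $ 1 + 2 * \<i> * L * z $ i $ 2 + g * (\<Sum>j\<in>UNIV. \<nu> j * P 1 i j) = 0"
      "L\<^sup>2 * z $ i $ 2 - 2 * \<i> * L * z $ i $ 1 + g * (\<Sum>j\<in>UNIV. \<nu> j * P 2 i j) = 0"
      using mass[of i] unfolding M_op_nth[OF z] \<nu>_def P_def g_def by (simp_all del: of_real_add of_real_divide)
  qed
  define x y where "x k = complex_of_real (edge (k + 1) (k + 2) $ 1)"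
    and "y k = complex_of_real (edge (k + 1) (k + 2) $ 2)" for k
  define U V where "U k = z $ (k + 1) $ 1 - z $ (k + 2) $ 1"
    and "V k = z $ (k + 1) $ 2 - z $ (k + 2) $ 2" for k
  have PU: "P 1 (k + 1) (k + 2) = (x k * U k + y k * V k) * x k"
    "P 2 (k + 1) (k + 2) = (x k * U k + y k * V k) * y k" for k
    by (simp_all add: P_def cdot_def x_def y_def U_def V_def)
  have "\<exists>c. (L \<noteq> 0 \<longrightarrow> c = 0) \<and> (\<forall>k. U k = - c * y k \<and> V k = c * x k)"
  proof (rule triangle_equations_solution[where \<mu> = \<nu> and g = g])
    show "(x k)\<^sup>2 + (y k)\<^sup>2 = 1" for k
    proof -
      have "k + 1 \<noteq> k + 2" by simp
      from edge_unit[OF this] show ?thesis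
        unfolding x_def y_def by (metis of_real_1 of_real_add of_real_power)
    qed
    show "(\<Sum>k\<in>UNIV. x k) = 0" "(\<Sum>k\<in>UNIV. y k) = 0"
      by (simp_all add: sum_3 x_def y_def edge_def Z3_numerals algebra_simps diff_divide_distrib)
    show "(\<Sum>k\<in>UNIV. \<nu> k) = 1" by (rule nu)
    show "(\<Sum>k\<in>UNIV. U k) = 0" "(\<Sum>k\<in>UNIV. V k) = 0"
      by (simp_all add: sum_3 U_def V_def Z3_numerals)
    show "L\<^sup>2 * U k + 2 * \<i> * L * V k +
        g * ((x k * U k + y k * V k) * x k - \<nu> k * (\<Sum>k\<in>UNIV. (x k * U k + y k * V k) * x k)) = 0" for k
    proof -
      have "L\<^sup>2 * U k + 2 * \<i> * L * V k +
        g * ((\<Sum>j\<in>UNIV. \<nu> j * P 1 (k + 1) j) - (\<Sum>j\<in>UNIV. \<nu> j * P 1 (k + 2) j)) = 0"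
      proof -
        have "L\<^sup>2 * U k + 2 * \<i> * L * V k + g * (A - B) =
            (L\<^sup>2 * z $ (k + 1) $ 1 + 2 * \<i> * L * z $ (k + 1) $ 2 + g * A) -
            (L\<^sup>2 * z $ (k + 2) $ 1 + 2 * \<i> * L * z $ (k + 2) $ 2 + g * B)" for A B
          by (simp add: U_def V_def algebra_simps)
        then show ?thesis by (simp only: F) simp
      qed
      then show ?thesis
        unfolding cyclic_difference[of "P 1", OF P nu] PU .
    qed
    show "L\<^sup>2 * V k - 2 * \<i> * L * U k +
        g * ((x k * U k + y k * V k) * y k - \<nu> k * (\<Sum>k\<in>UNIV. (x k * U k + y k * V k) * y k)) = 0" for k
    proof -
      have "L\<^sup>2 * V k - 2 * \<i> * L * U k +
        g * ((\<Sum>j\<in>UNIV. \<nu> j * P 2 (k + 1) j) - (\<Sum>j\<in>UNIV. \<nu> j * P 2 (k + 2) j)) = 0"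
      proof -
        have "L\<^sup>2 * V k - 2 * \<i> * L * U k + g * (A - B) =
            (L\<^sup>2 * z $ (k + 1) $ 2 - 2 * \<i> * L * z $ (k + 1) $ 1 + g * A) -
            (L\<^sup>2 * z $ (k + 2) $ 2 - 2 * \<i> * L * z $ (k + 2) $ 1 + g * B)" for A B
          by (simp add: U_def V_def algebra_simps)
        then show ?thesis by (simp only: F) simp
      qed
      then show ?thesis
        unfolding cyclic_difference[of "P 2", OF P nu] PU .
    qed
    let ?\<sigma> = "m $ 1 * m $ 2 + m $ 1 * m $ 3 + m $ 2 * m $ 3"
    let ?\<delta> = "(\<alpha> + 1)\<^sup>2 * (beta m / 36)"
    have "9 * (3 - \<alpha>)\<^sup>2 < beta m * (1 + \<alpha>)\<^sup>2"
      using beta alpha by (simp add: power_divide field_simps)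
    moreover have "4 * ?\<delta> = beta m * (1 + \<alpha>)\<^sup>2 / 9" by (simp add: add.commute)
    ultimately have disc: "(3 - \<alpha>)\<^sup>2 < 4 * ?\<delta>" by linarith
    \<comment> \<open>Completing the square: negative discriminant means no real root.\<close>
    have "4 * (l ^ 4 + ((\<alpha> + 1) - 4) * l\<^sup>2 + ?\<delta>) = (2 * l\<^sup>2 - (3 - \<alpha>))\<^sup>2 + (4 * ?\<delta> - (3 - \<alpha>)\<^sup>2)"
      by (simp add: power2_eq_square power4_eq_xxxx algebra_simps)
    also have "\<dots> > 0" using disc by (intro add_nonneg_pos) auto
    finally have pos: "l ^ 4 + ((\<alpha> + 1) - 4) * l\<^sup>2 + ?\<delta> \<noteq> 0" by (metis mult_zero_right less_irrefl)
    have "beta m / 36 = 3 / 4 * (m $ 1 / total * (m $ 2 / total) + m $ 1 / total * (m $ 3 / total) + m $ 2 / total * (m $ 3 / total))"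
      by (simp add: beta_def power2_eq_square add_divide_distrib mult_ac)
    then have "L ^ 4 + (g - 4) * L\<^sup>2 + g\<^sup>2 * (3 / 4 * (\<nu> 1 * \<nu> 2 + \<nu> 1 * \<nu> 3 + \<nu> 2 * \<nu> 3)) =
      of_real (l ^ 4 + ((\<alpha> + 1) - 4) * l\<^sup>2 + ?\<delta>)"
      by (simp add: L_def g_def \<nu>_def)
    with pos show "L ^ 4 + (g - 4) * L\<^sup>2 + g\<^sup>2 * (3 / 4 * (\<nu> 1 * \<nu> 2 + \<nu> 1 * \<nu> 3 + \<nu> 2 * \<nu> 3)) \<noteq> 0"
      by (simp only: of_real_eq_0_iff not_False_eq_True)
    show "L\<^sup>2 \<noteq> 4 - g" if "L \<noteq> 0"
    proof -
      have "l\<^sup>2 \<noteq> 4 - (\<alpha> + 1)" using homographic that by (auto simp: L_def)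
      moreover have "L\<^sup>2 = of_real (l\<^sup>2)" "4 - g = of_real (4 - (\<alpha> + 1))" by (simp_all add: L_def g_def)
      ultimately show ?thesis by (simp only: of_real_eq_iff) simp
    qed
    show "g \<noteq> 0" using alpha unfolding g_def of_real_eq_0_iff by simp
  qed
  then obtain c where c: "L \<noteq> 0 \<Longrightarrow> c = 0" and UV: "\<And>k. U k = - c * y k" "\<And>k. V k = c * x k" by blast
  define c' where "c' = c / of_real d"
  define v where "v = z - cscale c' (of_E3 (J3 a))"
  have step: "v $ (k + 1) $ n = v $ (k + 2) $ n" for k n
    using exhaust_2[of n] UV[of k] d
    by (auto simp: v_def c'_def U_def V_def x_def y_def edge_def cscale_def of_E3_def J3_def
        diff_divide_distrib algebra_simps)
  have const: "v $ 1 $ n = v $ 3 $ n" "v $ 2 $ n = v $ 3 $ n" for n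
    using step[of 1 n] step[of 2 n] by (simp_all add: Z3_numerals)
  have "v \<in> Ered"
    unfolding v_def by (intro subspace_diff[OF subspace_reduced] z J3_a_reduced)
  then have "of_real total * v $ 3 $ n = 0" for n
    by (simp add: mem_reduced_space sum_3 const algebra_simps)
  then have v3: "v $ 3 $ n = 0" for n
    using total_pos by (metis mult_eq_0_iff of_real_eq_0_iff less_irrefl)
  have "v = 0" by (simp add: vec_eq_iff forall_3 const v3)
  then have "z = cscale c' (of_E3 (J3 a))" by (simp add: v_def)
  moreover have "l \<noteq> 0 \<longrightarrow> c' = 0" using c by (simp add: L_def c'_def)
  ultimately show ?thesis by blast
qed

lemma PM_op_invertible:
  assumes "l \<noteq> 0" and "l\<^sup>2 \<noteq> 3 - \<alpha>" and beta: "beta m > 9 * ((3 - \<alpha>) / (1 + \<alpha>))\<^sup>2"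
  shows "PM_invertible m \<phi> a (of_real l)"
  unfolding PM_invertible_def
proof (rule bij_betw_subspaceI[OF linear_PM_op subspace_reduced])
  show "PM_op m \<phi> a (of_real l) ` Ered \<subseteq> Ered" using PM_op_in_reduced by blast
  fix z assume z: "z \<in> Ered" and "PM_op m \<phi> a (of_real l) z = 0"
  then have "M_op m \<phi> a (of_real l) z = 0" by (simp add: PM_op_eq_0_iff)
  from M_op_kernel[OF z this _ beta] assms show "z = 0"
    by (auto simp: cscale_def vec_eq_iff)
qed

lemma PM_op_zero_kernel:
  assumes beta: "beta m > 9 * ((3 - \<alpha>) / (1 + \<alpha>))\<^sup>2"
  shows "PM_zero_kernel_spanned m \<phi> a"
  unfolding PM_zero_kernel_spanned_def
proof (intro equalityI subsetI)
  fix z assume z: "z \<in> {z \<in> Ered. PM_op m \<phi> a 0 z = 0}"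
  then have "M_op m \<phi> a (of_real 0) z = 0" by (auto simp: PM_op_eq_0_iff)
  from M_op_kernel[OF _ this _ beta] z show "z \<in> range (\<lambda>c. cscale c (of_E3 (J3 a)))"
    by auto
next
  fix z assume "z \<in> range (\<lambda>c. cscale c (of_E3 (J3 a)))"
  then obtain c where z: "z = cscale c (of_E3 (J3 a))" by blast
  have red: "z \<in> Ered" unfolding z by (rule J3_a_reduced)
  have "cdot (edge i j) (z $ i - z $ j) = 0" for i j
    by (simp add: z cdot_def edge_def cscale_def of_E3_def J3_def algebra_simps diff_divide_distrib)
  then have "M_op m \<phi> a 0 z $ i $ k = 0" for i k
    using exhaust_2[of k] by (auto simp: M_op_nth[OF red])
  then have "M_op m \<phi> a 0 z = 0" by (simp add: vec_eq_iff)
  with red show "z \<in> {z \<in> Ered. PM_op m \<phi> a 0 z = 0}" by (simp add: PM_op_eq_0_iff)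
qed

end

section \<open>Nondegeneracy\<close>

theorem mainTheorem5:
  fixes m :: "real ^ 3" and \<alpha> :: real and \<phi> :: "real \<Rightarrow> real" and a :: "real ^ 2 ^ 3"
  assumes "m $ 1 > 0" and "m $ 2 > 0" and "m $ 3 > 0"
    and "\<alpha> \<ge> 1"
    and "is_pair_potential \<alpha> \<phi>"
    and "lagrange_configuration m \<alpha> \<phi> a"
  shows "(\<alpha> = 2 \<and> beta m > 1 \<longrightarrow> (\<forall>k::int. k > 1 \<longrightarrow> nondegenerate_frac m \<phi> a k)) \<and>
    (\<forall>p::int. \<alpha> \<noteq> 2 \<and> p > 0 \<and>
        of_int p * csqrt (of_real (3 - \<alpha>)) \<notin> of_nat ` {1..} \<and>
        beta m > 9 * ((3 - \<alpha>) / (1 + \<alpha>))\<^sup>2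
      \<longrightarrow> nondegenerate_mult m \<phi> a p)"
proof -
  have "m $ i > 0" for i using exhaust_3[of i] assms(1-3) by auto
  then obtain d where "lagrange_triangle m \<alpha> \<phi> a d"
    using assms(4-6) by (auto simp: lagrange_configuration_def lagrange_triangle_def)
  then interpret lagrange_triangle m \<alpha> \<phi> a d .
  show ?thesis
  proof (intro conjI impI allI)
    fix k :: int
    assume h: "\<alpha> = 2 \<and> beta m > 1" and k: "k > 1"
    then have b: "beta m > 9 * ((3 - \<alpha>) / (1 + \<alpha>))\<^sup>2" by (simp add: power2_eq_square)
    show "nondegenerate_frac m \<phi> a k"
      unfolding nondegenerate_frac_def
    proof (intro conjI allI impI PM_op_zero_kernel b)
      fix l :: int assume l: "l \<noteq> 0 \<and> k dvd l"
      then have "k \<le> \<bar>l\<bar>" using k dvd_imp_le_int[of l k] by simp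
      then have "1 < \<bar>real_of_int l\<bar>" using k by linarith
      then have "1 < (real_of_int l)\<^sup>2"
        using one_less_power[of "\<bar>real_of_int l\<bar>" 2] by simp
      then have "(real_of_int l)\<^sup>2 \<noteq> 3 - \<alpha>" using h by linarith
      then have "PM_invertible m \<phi> a (of_real (of_int l))" using l b by (intro PM_op_invertible) auto
      then show "PM_invertible m \<phi> a (of_int l)" by simp
    qed
  next
    fix p :: int
    assume h: "\<alpha> \<noteq> 2 \<and> p > 0 \<and> of_int p * csqrt (of_real (3 - \<alpha>)) \<notin> of_nat ` {1..} \<and>
        beta m > 9 * ((3 - \<alpha>) / (1 + \<alpha>))\<^sup>2"
    show "nondegenerate_mult m \<phi> a p"
      unfolding nondegenerate_mult_def
    proof (intro conjI allI impI PM_op_zero_kernel)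
      fix l :: int assume l: "l \<noteq> 0"
      let ?q = "real_of_int l / real_of_int p"
      have "?q\<^sup>2 \<noteq> 3 - \<alpha>"
      proof
        assume q: "?q\<^sup>2 = 3 - \<alpha>"
        have "csqrt (of_real (3 - \<alpha>)) = of_real (sqrt (?q\<^sup>2))"
          by (subst csqrt_of_real_nonneg) (simp_all flip: q)
        also have "\<dots> = of_real (real_of_int \<bar>l\<bar> / real_of_int p)"
          using h by (simp add: abs_divide)
        finally have "of_int p * csqrt (of_real (3 - \<alpha>)) = of_nat (nat \<bar>l\<bar>)"
          using h by (simp del: of_int_abs)
        moreover have "nat \<bar>l\<bar> \<in> {1..}" using l by auto
        ultimately show False using h by blast
      qed
      then have "PM_invertible m \<phi> a (of_real ?q)" using l h by (intro PM_op_invertible) auto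
      then show "PM_invertible m \<phi> a (of_int l / of_int p)" by simp
    qed (use h in auto)
  qed
qed

end
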